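(* Let $(P,T,F,M_0,W)$ be a Petri net whose transition set $T$ is partitioned into sets $T_C,T_1,\dots,T_n$ such that (a) for every $i$ and $t\in T_i$, the equivalence class $[t]_{\diamond^+}$ is contained in $T_i$, and (b) every $t\in T_C$ has no input place, i.e. $N^-(t)=\emptyset$. Put $C=\{\mathsf{fire}_t\}_{t\in T_C}$, $O_i=\{\mathsf{fire}_t\}_{t\in T_i}$, $\Sigma=C\cup\bigcup_iO_i$, $Q=\{\mathsf{marking}\}$, where for a trace $v\in\mathbb{M}(\Sigma)$ and $p\in P$ $$\mathsf{marking}(v)(p)=M_0(p)+\sum_{\mathsf{fire}_t\in v:\ t\in N^-(p)}W(t,p)-\sum_{\mathsf{fire}_t\in v:\ t\in N^+(p)}W(p,t),$$ the sums ranging over the occurrences (with multiplicity) of letters $\mathsf{fire}_t$ in $v$. Let $$L=\{v\in\mathbb{M}(\Sigma)\mid\forall p\in P:\ \mathsf{marking}(v)(p)\ge 0\}.$$ Then $(C,(O_j)_{j\in[1..n]},L,Q)$ specifies a Process-Commutative Object; that is, $L$ satisfies Initial emptiness, $C^*$-closure and $I$-diamond closure.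
   Context: **Petri net.** A 5-tuple $(P,T,F,M_0,W)$: $P$ (places) and $T$ (transitions) are disjoint sets; $F\subseteq(P\times T)\cup(T\times P)$ is a set of directed edges; $M_0\in\mathbb{N}^P$ is the initial marking; $W\in(\mathbb{N}_{>0})^F$ gives edge weights. $N^-(x)$ and $N^+(x)$ are the sets of direct predecessors and direct successors of a vertex $x$ in the directed bipartite graph $(P\cup T,F)$. Two transitions are in conflict, $t_1\diamond t_2$, if $N^-(t_1)\cap N^-(t_2)\ne\emptyset$; $\diamond^+$ is the reflexive transitive closure of $\diamond$ (an equivalence relation) and $[t]_{\diamond^+}$ is the class of $t$. **Process-Commutative Object specification.** Given pairwise disjoint sets of updates $C$ (common updates) and $O_1,\dots,O_n$ ($O_i$ exclusive to process $p_i$), let $\Sigma=C\cup\bigcup_i O_i$, $I=\Sigma\times\Sigma\setminus\bigcup_i(O_i\times O_i)$, let $\sim_I$ be the least congruence on $\Sigma^*$ with $ab\sim_I ba$ for $(a,b)\in I$, and let $\mathbb{M}(\Sigma)=\Sigma^*/{\sim_I}$ be the trace monoid, with concatenation $\oplus$ and empty trace $\epsilon$. A tuple $(C,(O_j)_j,L,Q)$, with $L\subseteq \mathbb{M}(\Sigma)$ and $Q$ a set of query functions $L\to\mathbb{V}$ ($\mathbb{V}$ a set of output values), specifies a Process-Commutative Object if: - *Initial emptiness*: $\epsilon\in L$; - *$C^*$-closure*: if $v\in L$ and $w$ is a trace all of whose letters are in $C$, then $v\oplus w\in L$; - *$I$-diamond closure*: for all $i$, $v\in L$, $\mathsf{op}_i\in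 O_i$ and every trace $z$ with all letters in $\Sigma\setminus O_i$, if $v\oplus \mathsf{op}_i\in L$ and $v\oplus z\in L$ then $v\oplus z\oplus \mathsf{op}_i\in L$. Updates $\mathsf{fire}_t$ are silent (return a constant). *)

theory Defs
  imports "HOL-Library.Multiset" "HOL-Library.FuncSet" "HOL-Library.Disjoint_Sets"
begin

section \<open>Petri nets\<close>

record 'x petri_net =
  places :: "'x set"
  transitions :: "'x set"
  flow :: "('x \<times> 'x) set"
  init_marking :: "'x \<Rightarrow> nat"
  weight :: "'x \<times> 'x \<Rightarrow> nat"

text \<open>Only the values of \<^const>\<open>init_marking\<close> on places and of \<^const>\<open>weight\<close> on edges matter.\<close>

definition petri_net :: "'x petri_net \<Rightarrow> bool" where
  "petri_net N \<longleftrightarrow>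
     places N \<inter> transitions N = {} \<and>
     flow N \<subseteq> places N \<times> transitions N \<union> transitions N \<times> places N \<and>
     (\<forall>e\<in>flow N. weight N e > 0)"

definition preds :: "'x petri_net \<Rightarrow> 'x \<Rightarrow> 'x set" where
  "preds N x = {y. (y, x) \<in> flow N}"

definition succs :: "'x petri_net \<Rightarrow> 'x \<Rightarrow> 'x set" where
  "succs N x = {y. (x, y) \<in> flow N}"

definition conflict :: "'x petri_net \<Rightarrow> ('x \<times> 'x) set" where
  "conflict N = {(t1, t2). t1 \<in> transitions N \<and> t2 \<in> transitions N \<and> preds N t1 \<inter> preds N t2 \<noteq> {}}"

definition conflict_class :: "'x petri_net \<Rightarrow> 'x \<Rightarrow> 'x set" where
  "conflict_class N t = (conflict N)\<^sup>* `` {t}"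


section \<open>Trace monoids\<close>

text \<open>The least congruence on the free monoid over \<open>\<Sigma>\<close> that makes independent letters commute.\<close>

inductive_set trace_cong :: "'u set \<Rightarrow> ('u \<times> 'u) set \<Rightarrow> ('u list \<times> 'u list) set"
  for \<Sigma> :: "'u set" and I :: "('u \<times> 'u) set"
where
  swap: "a \<in> \<Sigma> \<Longrightarrow> b \<in> \<Sigma> \<Longrightarrow> (a, b) \<in> I \<Longrightarrow> ([a, b], [b, a]) \<in> trace_cong \<Sigma> I"
| refl: "u \<in> lists \<Sigma> \<Longrightarrow> (u, u) \<in> trace_cong \<Sigma> I"
| sym: "(u, v) \<in> trace_cong \<Sigma> I \<Longrightarrow> (v, u) \<in> trace_cong \<Sigma> I"
| trans: "(u, v) \<in> trace_cong \<Sigma> I \<Longrightarrow> (v, w) \<in> trace_cong \<Sigma> I \<Longrightarrow> (u, w) \<in> trace_cong \<Sigma> I"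
| append: "(u, v) \<in> trace_cong \<Sigma> I \<Longrightarrow> (u', v') \<in> trace_cong \<Sigma> I \<Longrightarrow>
    (u @ u', v @ v') \<in> trace_cong \<Sigma> I"

type_synonym 'u trace = "'u list set"

definition traces :: "'u set \<Rightarrow> ('u \<times> 'u) set \<Rightarrow> 'u trace set" where
  "traces \<Sigma> I = lists \<Sigma> // trace_cong \<Sigma> I"

definition trace_of :: "'u set \<Rightarrow> ('u \<times> 'u) set \<Rightarrow> 'u list \<Rightarrow> 'u trace" where
  "trace_of \<Sigma> I w = trace_cong \<Sigma> I `` {w}"

definition trace_concat :: "'u set \<Rightarrow> ('u \<times> 'u) set \<Rightarrow> 'u trace \<Rightarrow> 'u trace \<Rightarrow> 'u trace" where
  "trace_concat \<Sigma> I v w = (\<Union>x\<in>v. \<Union>y\<in>w. trace_of \<Sigma> I (x @ y))"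

text \<open>All representatives of a trace have the same multiset of letters (\<open>letters_trace_of\<close> below),
  so this is the multiset of letter occurrences in the trace.\<close>

definition letters :: "'u trace \<Rightarrow> 'u multiset" where
  "letters v = the_elem (mset ` v)"

lemma trace_cong_lists:
  "(u, v) \<in> trace_cong \<Sigma> I \<Longrightarrow> u \<in> lists \<Sigma> \<and> v \<in> lists \<Sigma>"
  by (induction rule: trace_cong.induct) auto

lemma equiv_trace_cong: "equiv (lists \<Sigma>) (trace_cong \<Sigma> I)"
proof (rule equivI)
  show "trace_cong \<Sigma> I \<subseteq> lists \<Sigma> \<times> lists \<Sigma>"
    by (auto dest: trace_cong_lists simp del: in_lists_conv_set)
  show "refl_on (lists \<Sigma>) (trace_cong \<Sigma> I)"
    by (rule refl_onI) (rule trace_cong.refl)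
  show "sym (trace_cong \<Sigma> I)"
    by (rule symI) (rule trace_cong.sym)
  show "trans (trace_cong \<Sigma> I)"
    by (rule transI) (rule trace_cong.trans)
qed

lemma trace_of_eq_iff:
  assumes "u \<in> lists \<Sigma>" "v \<in> lists \<Sigma>"
  shows "trace_of \<Sigma> I u = trace_of \<Sigma> I v \<longleftrightarrow> (u, v) \<in> trace_cong \<Sigma> I"
  unfolding trace_of_def using assms by (rule eq_equiv_class_iff[OF equiv_trace_cong])

lemma trace_concat_trace_of:
  assumes "u \<in> lists \<Sigma>" "v \<in> lists \<Sigma>"
  shows "trace_concat \<Sigma> I (trace_of \<Sigma> I u) (trace_of \<Sigma> I v) = trace_of \<Sigma> I (u @ v)"
proof -
  have "trace_of \<Sigma> I (x @ y) = trace_of \<Sigma> I (u @ v)"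
    if "x \<in> trace_of \<Sigma> I u" "y \<in> trace_of \<Sigma> I v" for x y
  proof -
    have "(u @ v, x @ y) \<in> trace_cong \<Sigma> I"
      using that unfolding trace_of_def Image_singleton_iff by (rule trace_cong.append)
    then show ?thesis
      unfolding trace_of_def by (rule equiv_class_eq[OF equiv_trace_cong, symmetric])
  qed
  moreover have "u \<in> trace_of \<Sigma> I u" "v \<in> trace_of \<Sigma> I v"
    using assms unfolding trace_of_def Image_singleton_iff by (iprover intro: trace_cong.refl)+
  ultimately show ?thesis
    unfolding trace_concat_def by blast
qed

lemma letters_trace_of:
  assumes "w \<in> lists \<Sigma>"
  shows "letters (trace_of \<Sigma> I w) = mset w"
proof -
  have *: "mset u = mset v" if "(u, v) \<in> trace_cong \<Sigma> I" for u v
    using that by induction simp_all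
  have "w \<in> trace_of \<Sigma> I w"
    using assms unfolding trace_of_def Image_singleton_iff by (rule trace_cong.refl)
  moreover have "mset x = mset w" if "x \<in> trace_of \<Sigma> I w" for x
    using that unfolding trace_of_def Image_singleton_iff by (rule *[symmetric])
  ultimately have "mset ` trace_of \<Sigma> I w = {mset w}"
    by blast
  then show ?thesis
    by (simp add: letters_def)
qed


section \<open>Process-commutative objects\<close>

definition pco_alphabet :: "nat \<Rightarrow> 'u set \<Rightarrow> (nat \<Rightarrow> 'u set) \<Rightarrow> 'u set" where
  "pco_alphabet n C Ob = C \<union> (\<Union>i\<in>{1..n}. Ob i)"

definition pco_indep :: "nat \<Rightarrow> 'u set \<Rightarrow> (nat \<Rightarrow> 'u set) \<Rightarrow> ('u \<times> 'u) set" where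
  "pco_indep n C Ob =
     pco_alphabet n C Ob \<times> pco_alphabet n C Ob - (\<Union>i\<in>{1..n}. Ob i \<times> Ob i)"

definition pco_traces :: "nat \<Rightarrow> 'u set \<Rightarrow> (nat \<Rightarrow> 'u set) \<Rightarrow> 'u trace set" where
  "pco_traces n C Ob = traces (pco_alphabet n C Ob) (pco_indep n C Ob)"

definition pco_trace_of :: "nat \<Rightarrow> 'u set \<Rightarrow> (nat \<Rightarrow> 'u set) \<Rightarrow> 'u list \<Rightarrow> 'u trace" where
  "pco_trace_of n C Ob = trace_of (pco_alphabet n C Ob) (pco_indep n C Ob)"

definition pco_concat ::
  "nat \<Rightarrow> 'u set \<Rightarrow> (nat \<Rightarrow> 'u set) \<Rightarrow> 'u trace \<Rightarrow> 'u trace \<Rightarrow> 'u trace" where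
  "pco_concat n C Ob = trace_concat (pco_alphabet n C Ob) (pco_indep n C Ob)"

definition initial_emptiness ::
  "nat \<Rightarrow> 'u set \<Rightarrow> (nat \<Rightarrow> 'u set) \<Rightarrow> 'u trace set \<Rightarrow> bool" where
  "initial_emptiness n C Ob L \<longleftrightarrow> pco_trace_of n C Ob [] \<in> L"

definition common_closure ::
  "nat \<Rightarrow> 'u set \<Rightarrow> (nat \<Rightarrow> 'u set) \<Rightarrow> 'u trace set \<Rightarrow> bool" where
  "common_closure n C Ob L \<longleftrightarrow>
     (\<forall>v\<in>L. \<forall>w\<in>pco_traces n C Ob. set_mset (letters w) \<subseteq> C \<longrightarrow> pco_concat n C Ob v w \<in> L)"

definition diamond_closure ::
  "nat \<Rightarrow> 'u set \<Rightarrow> (nat \<Rightarrow> 'u set) \<Rightarrow> 'u trace set \<Rightarrow> bool" where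
  "diamond_closure n C Ob L \<longleftrightarrow>
     (\<forall>i\<in>{1..n}. \<forall>v\<in>L. \<forall>a\<in>Ob i. \<forall>z\<in>pco_traces n C Ob.
        set_mset (letters z) \<subseteq> pco_alphabet n C Ob - Ob i \<longrightarrow>
        pco_concat n C Ob v (pco_trace_of n C Ob [a]) \<in> L \<longrightarrow>
        pco_concat n C Ob v z \<in> L \<longrightarrow>
        pco_concat n C Ob (pco_concat n C Ob v z) (pco_trace_of n C Ob [a]) \<in> L)"

text \<open>The set of output values is the type \<open>'o\<close>; queries are functions with domain \<open>L\<close>.\<close>

definition specifies_PCO ::
  "nat \<Rightarrow> 'u set \<Rightarrow> (nat \<Rightarrow> 'u set) \<Rightarrow> 'u trace set \<Rightarrow> ('u trace \<Rightarrow> 'o) set \<Rightarrow> bool" where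
  "specifies_PCO n C Ob L Q \<longleftrightarrow>
     (\<forall>i\<in>{1..n}. C \<inter> Ob i = {}) \<and> disjoint_family_on Ob {1..n} \<and>
     L \<subseteq> pco_traces n C Ob \<and> Q \<subseteq> L \<rightarrow>\<^sub>E UNIV \<and>
     initial_emptiness n C Ob L \<and> common_closure n C Ob L \<and> diamond_closure n C Ob L"


section \<open>Markings reached by traces of firings\<close>

datatype 'x update = Fire (fired: 'x)

definition marking :: "'x petri_net \<Rightarrow> 'x update trace \<Rightarrow> 'x \<Rightarrow> int" where
  "marking N v = (\<lambda>p\<in>places N. int (init_marking N p)
     + (\<Sum>u\<in>#{#u \<in># letters v. fired u \<in> preds N p#}. int (weight N (fired u, p)))
     - (\<Sum>u\<in>#{#u \<in># letters v. fired u \<in> succs N p#}. int (weight N (p, fired u))))"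

end

theory Submission
  imports Defs
begin

text \<open>The marking reached by a trace depends only on its multiset of letters, additively. A common
  update never removes tokens, having no input place. For the diamond, consider an update of
  process \<open>i\<close> and a trace \<open>z\<close> without updates of process \<open>i\<close>: from a place that feeds the update,
  \<open>z\<close> removes no tokens, as this would be a conflict crossing two classes; from any other place the
  update itself removes none. So at every place one of the two given markings bounds the final
  one from below.\<close>

lemma trace_of_in_traces:
  "w \<in> lists \<Sigma> \<Longrightarrow> trace_of \<Sigma> I w \<in> traces \<Sigma> I"
  unfolding traces_def trace_of_def by (rule quotientI)

lemma tracesE:
  assumes "v \<in> traces \<Sigma> I"
  obtains w where "w \<in> lists \<Sigma>" "v = trace_of \<Sigma> I w"
  using assms unfolding traces_def trace_of_def by (rule quotientE)

lemma trace_concat_in_traces: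
  assumes "v \<in> traces \<Sigma> I" "w \<in> traces \<Sigma> I"
  shows "trace_concat \<Sigma> I v w \<in> traces \<Sigma> I"
proof -
  obtain x where x: "x \<in> lists \<Sigma>" "v = trace_of \<Sigma> I x"
    using assms(1) by (rule tracesE)
  obtain y where y: "y \<in> lists \<Sigma>" "w = trace_of \<Sigma> I y"
    using assms(2) by (rule tracesE)
  have "x @ y \<in> lists \<Sigma>"
    using x(1) y(1) by simp
  then show ?thesis
    unfolding x(2) y(2) trace_concat_trace_of[OF x(1) y(1)] by (rule trace_of_in_traces)
qed

text \<open>Both traces have representing words, and concatenating traces amounts to appending those
  words, on which \<open>mset\<close> is additive. This makes markings computable without looking at
  the order of letters.\<close>

lemma letters_trace_concat:
  assumes "v \<in> traces \<Sigma> I" "w \<in> traces \<Sigma> I"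
  shows "letters (trace_concat \<Sigma> I v w) = letters v + letters w"
proof -
  obtain x where x: "x \<in> lists \<Sigma>" "v = trace_of \<Sigma> I x"
    using assms(1) by (rule tracesE)
  obtain y where y: "y \<in> lists \<Sigma>" "w = trace_of \<Sigma> I y"
    using assms(2) by (rule tracesE)
  have "x @ y \<in> lists \<Sigma>"
    using x(1) y(1) by simp
  then show ?thesis
    unfolding x(2) y(2) trace_concat_trace_of[OF x(1) y(1)]
    by (simp only: letters_trace_of x(1) y(1) mset_append)
qed

text \<open>The initial marking is left out so that the effect is additive in \<open>m\<close>;
  working on multisets keeps the arithmetic free of trace quotients.\<close>

definition token_change :: "'x petri_net \<Rightarrow> 'x update multiset \<Rightarrow> 'x \<Rightarrow> int" where
  "token_change N m p =
     (\<Sum>u\<in>#{#u \<in># m. fired u \<in> preds N p#}. int (weight N (fired u, p)))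
     - (\<Sum>u\<in>#{#u \<in># m. fired u \<in> succs N p#}. int (weight N (p, fired u)))"

lemma marking_eq_token_change:
  "p \<in> places N \<Longrightarrow> marking N v p = int (init_marking N p) + token_change N (letters v) p"
  by (simp add: marking_def token_change_def)

lemma token_change_empty [simp]: "token_change N {#} p = 0"
  by (simp add: token_change_def)

lemma token_change_union:
  "token_change N (m + m') p = token_change N m p + token_change N m' p"
  by (simp add: token_change_def)

text \<open>\<open>fired u \<in> succs N p\<close> and \<open>p \<in> preds N (fired u)\<close> name
  the same edge, so the hypothesis empties the subtracted sum. What remains is a sum of natural
  numbers.\<close>

lemma token_change_nonneg:
  assumes "\<And>u. u \<in># m \<Longrightarrow> p \<notin> preds N (fired u)"
  shows "0 \<le> token_change N m p"
proof -
  have "{#u \<in># m. fired u \<in> succs N p#} = {#}"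
    using assms by (auto simp: filter_mset_eq_conv preds_def succs_def)
  moreover have "0 \<le> (\<Sum>u\<in>#M. int (weight N (fired u, p)))" for M
    by (induction M) simp_all
  ultimately show ?thesis
    by (simp only: token_change_def image_mset_empty sum_mset.empty diff_zero)
qed

theorem theorem4:
  fixes N :: "'x petri_net"
    and n :: nat
    and T_C :: "'x set"
    and Tp :: "nat \<Rightarrow> 'x set"
    and C :: "'x update set"
    and Ob :: "nat \<Rightarrow> 'x update set"
    and L :: "'x update trace set"
    and Q :: "('x update trace \<Rightarrow> 'x \<Rightarrow> int) set"
  assumes net: "petri_net N"
    and cover: "transitions N = T_C \<union> (\<Union>i\<in>{1..n}. Tp i)"
    and disj_common: "\<And>i. i \<in> {1..n} \<Longrightarrow> T_C \<inter> Tp i = {}"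
    and disj_exclusive: "disjoint_family_on Tp {1..n}"
    and conflict_closed: "\<And>i t. i \<in> {1..n} \<Longrightarrow> t \<in> Tp i \<Longrightarrow> conflict_class N t \<subseteq> Tp i"
    and common_no_input: "\<And>t. t \<in> T_C \<Longrightarrow> preds N t = {}"
    and C_eq: "C = Fire ` T_C"
    and Ob_eq: "\<And>i. i \<in> {1..n} \<Longrightarrow> Ob i = Fire ` Tp i"
    and L_eq: "L = {v \<in> pco_traces n C Ob. \<forall>p\<in>places N. marking N v p \<ge> 0}"
    and Q_eq: "Q = {restrict (marking N) L}"
  shows "specifies_PCO n C Ob L Q"
proof -
  let ?\<Sigma> = "pco_alphabet n C Ob" and ?I = "pco_indep n C Ob"
  have alphabet: "?\<Sigma> = Fire ` transitions N"
    using Ob_eq unfolding pco_alphabet_def C_eq cover by auto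
  \<comment> \<open>From here on, membership in \<open>L\<close> is an inequality between integers
    at each place, in which the trace enters only through its letters.\<close>
  have L_iff: "v \<in> L \<longleftrightarrow> v \<in> traces ?\<Sigma> ?I \<and>
      (\<forall>p\<in>places N. 0 \<le> int (init_marking N p) + token_change N (letters v) p)" for v
    by (auto simp: L_eq pco_traces_def marking_eq_token_change)
  have "C \<inter> Ob i = {}" if "i \<in> {1..n}" for i
    using disj_common[OF that] Ob_eq[OF that] C_eq by auto
  moreover have "disjoint_family_on Ob {1..n}"
    using disj_exclusive Ob_eq unfolding disjoint_family_on_def by fastforce
  moreover have "L \<subseteq> pco_traces n C Ob"
    using L_eq by blast
  moreover have "Q \<subseteq> L \<rightarrow>\<^sub>E UNIV"
    using Q_eq by simp
  \<comment> \<open>With no letters the token change is 0, and the initial marking is a natural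
    number.\<close>
  moreover have "initial_emptiness n C Ob L"
    unfolding initial_emptiness_def pco_trace_of_def L_iff
    by (simp add: trace_of_in_traces letters_trace_of)
  moreover have "common_closure n C Ob L"
    unfolding common_closure_def pco_concat_def pco_traces_def
  proof (intro ballI impI)
    fix v w
    assume v: "v \<in> L" and w: "w \<in> traces ?\<Sigma> ?I" and common: "set_mset (letters w) \<subseteq> C"
    have "0 \<le> token_change N (letters w) p" for p
      using common common_no_input C_eq by (intro token_change_nonneg) fastforce
    then show "trace_concat ?\<Sigma> ?I v w \<in> L"
      using v w unfolding L_iff
      by (simp add: trace_concat_in_traces letters_trace_concat token_change_union
          add.assoc[symmetric])
  qed
  moreover have "diamond_closure n C Ob L"
    unfolding diamond_closure_def pco_concat_def pco_traces_def pco_trace_of_def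
  proof (intro ballI impI)
    fix i v a z
    assume i: "i \<in> {1..n}" and v: "v \<in> L" and a: "a \<in> Ob i" and z: "z \<in> traces ?\<Sigma> ?I"
      and others: "set_mset (letters z) \<subseteq> ?\<Sigma> - Ob i"
      and va: "trace_concat ?\<Sigma> ?I v (trace_of ?\<Sigma> ?I [a]) \<in> L"
      and vz: "trace_concat ?\<Sigma> ?I v z \<in> L"
    have a_lists: "[a] \<in> lists ?\<Sigma>"
      using a i by (auto simp: pco_alphabet_def)
    let ?a = "trace_of ?\<Sigma> ?I [a]"
    note traces = trace_of_in_traces[OF a_lists, of ?I] z v[unfolded L_iff, THEN conjunct1]
    note simps = trace_concat_in_traces letters_trace_concat token_change_union traces
    \<comment> \<open>By additivity this is the marking of \<open>v\<close> followed by
      \<open>z\<close> and \<open>a\<close>, so it is the whole claim.\<close>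
    have "0 \<le> int (init_marking N p) + token_change N (letters v) p
        + token_change N (letters z) p + token_change N (letters ?a) p" if p: "p \<in> places N" for p
    proof (cases "p \<in> preds N (fired a)")
      case True
      have "0 \<le> token_change N (letters z) p"
      proof (rule token_change_nonneg)
        fix u assume u: "u \<in># letters z"
        show "p \<notin> preds N (fired u)"
        proof
          assume "p \<in> preds N (fired u)"
          moreover have "fired u \<in> transitions N" "fired a \<in> transitions N"
            using u others a i cover Ob_eq[OF i] unfolding alphabet by auto
          \<comment> \<open>The shared input place \<open>p\<close> gives a single conflict step
            from \<open>fired a\<close> to \<open>fired u\<close>, which already lies in the
            closure.\<close>
          ultimately have "fired u \<in> conflict_class N (fired a)"
            using True by (auto simp: conflict_class_def conflict_def)
          moreover have "fired a \<in> Tp i"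
            using a Ob_eq[OF i] by auto
          ultimately have "fired u \<in> Tp i"
            using conflict_closed[OF i] by blast
          then have "u \<in> Ob i"
            unfolding Ob_eq[OF i] by (metis imageI update.collapse)
          then show False
            using u others by blast
        qed
      qed
      moreover have "0 \<le> int (init_marking N p) + token_change N (letters v) p
          + token_change N (letters ?a) p"
        using va p unfolding L_iff by (simp add: simps add.assoc)
      ultimately show ?thesis
        by linarith
    next
      case False
      \<comment> \<open>The only letter of the one-letter trace is \<open>a\<close>, which does not
        consume from \<open>p\<close>.\<close>
      then have "0 \<le> token_change N (letters ?a) p"
        by (intro token_change_nonneg) (simp add: letters_trace_of[OF a_lists])
      moreover have "0 \<le> int (init_marking N p) + token_change N (letters v) p
          + token_change N (letters z) p"
        using vz p unfolding L_iff by (simp add: simps add.assoc)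
      ultimately show ?thesis
        by linarith
    qed
    then show "trace_concat ?\<Sigma> ?I (trace_concat ?\<Sigma> ?I v z) ?a \<in> L"
      unfolding L_iff by (simp add: simps add.assoc)
  qed
  ultimately show ?thesis
    unfolding specifies_PCO_def by blast
qed

end
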